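(* The co-word problem of Grigorchuk's group $G=\langle a,b,c,d\rangle$, that is, the language $\{w\in\{a,b,c,d\}^*\mid w\ne_G 1\}$ of words representing non-trivial elements of $G$, is an ET0L language.
   Context: Grigorchuk's group $G$ is the group of automorphisms of the infinite rooted binary tree (vertices are finite strings over $\{0,1\}$) generated by $a,b,c,d$, given in wreath recursion notation by $a=(1,1)\alpha$, $b=(a,c)1$, $c=(a,d)1$, $d=(1,b)1$, where $\alpha$ swaps the two subtrees at the root. Explicitly, for every string $u$: $a(0u)=1u$, $a(1u)=0u$; $b(0u)=0\,a(u)$, $b(1u)=1\,c(u)$; $c(0u)=0\,a(u)$, $c(1u)=1\,d(u)$; $d(0u)=0u$, $d(1u)=1\,b(u)$; all fix the empty string. All alphabets are finite. A table over an alphabet $C$ is a finite subset $h\subseteq C\times C^*$; if $h$ contains no pair with first coordinate $c\in C$, then by convention $(c,c)$ is taken to belong to $h$. For words $u=c_1\cdots c_m$ (with $c_j\in C$) and $v\in C^*$ write $u\longrightarrow^h v$ if $v=v_1\cdots v_m$ with $(c_j,v_j)\in h$ for every $j$. For a word $r=h_1\cdots h_n$ over a set of tables, $u\longrightarrow^r v$ means there are words $u=u_0,u_1,\dots,u_n=v$ with $u_{j-1}\longrightarrow^{h_j}u_j$ for all $j$. A language $L\subseteq A^*$ is ET0L if there are an alphabet $C\supseteq A$, a finite set $H$ of tables over $C$, a regular language $\mathcal R\subseteq H^*$ and a letter $s\in C$ such that $L=\{w\in A^*\mid s\longrightarrow^r w\text{ for some }r\in\mathcal R\}$. *)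

theory Defs
  imports "HOL-Algebra.Elementary_Groups"
begin

section \<open>ET0L languages\<close>

definition regular_lang :: "'h set \<Rightarrow> 'h list set \<Rightarrow> bool" where
  "regular_lang H R \<longleftrightarrow>
     (\<exists>(Q :: nat set) \<delta> q0 F.
        finite Q \<and> q0 \<in> Q \<and> F \<subseteq> Q \<and> (\<forall>q\<in>Q. \<forall>h\<in>H. \<delta> q h \<in> Q) \<and>
        R = {r \<in> lists H. foldl \<delta> q0 r \<in> F})"

type_synonym 'c table = "('c \<times> 'c list) set"

definition is_table :: "'c set \<Rightarrow> 'c table \<Rightarrow> bool" where
  "is_table C h \<longleftrightarrow> finite h \<and> h \<subseteq> C \<times> lists C"

text \<open>Letters for which a table has no rule are copied.\<close>

definition completed :: "'c set \<Rightarrow> 'c table \<Rightarrow> 'c table" where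
  "completed C h = h \<union> {(c, [c]) |c. c \<in> C \<and> (\<forall>v. (c, v) \<notin> h)}"

definition table_step :: "'c set \<Rightarrow> 'c table \<Rightarrow> 'c list \<Rightarrow> 'c list \<Rightarrow> bool" where
  "table_step C h u v \<longleftrightarrow>
     (\<exists>vs. v = concat vs \<and> list_all2 (\<lambda>c w. (c, w) \<in> completed C h) u vs)"

fun table_steps :: "'c set \<Rightarrow> 'c table list \<Rightarrow> 'c list \<Rightarrow> 'c list \<Rightarrow> bool" where
  "table_steps C [] u v \<longleftrightarrow> u = v"
| "table_steps C (h # r) u v \<longleftrightarrow> (\<exists>u'. table_step C h u u' \<and> table_steps C r u' v)"

text \<open>
  The extended alphabet of a language over \<open>A :: 'a set\<close> lives in \<open>'a + nat\<close>: the letters of \<open>A\<close>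
  are embedded by \<open>Inl\<close>, and \<open>Inr\<close> supplies unboundedly many further letters, so that up to
  renaming every finite alphabet containing \<open>A\<close> occurs.
\<close>

definition ET0L :: "'a set \<Rightarrow> 'a list set \<Rightarrow> bool" where
  "ET0L A L \<longleftrightarrow>
     (\<exists>(C :: ('a + nat) set) H R s.
        finite C \<and> Inl ` A \<subseteq> C \<and>
        finite H \<and> (\<forall>h\<in>H. is_table C h) \<and>
        regular_lang H R \<and> s \<in> C \<and>
        L = {w \<in> lists A. \<exists>r\<in>R. table_steps C r [s] (map Inl w)})"


section \<open>Grigorchuk's group\<close>

text \<open>
  The vertices of the infinite rooted binary tree are the lists of booleans, where \<open>False\<close> is the
  letter 0 and \<open>True\<close> is the letter 1.
\<close>

definition child :: "bool list \<Rightarrow> bool list \<Rightarrow> bool" where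
  "child u v \<longleftrightarrow> (\<exists>x. v = u @ [x])"

definition tree_automorphism :: "(bool list \<Rightarrow> bool list) \<Rightarrow> bool" where
  "tree_automorphism f \<longleftrightarrow> bij f \<and> f [] = [] \<and> (\<forall>u v. child (f u) (f v) \<longleftrightarrow> child u v)"

definition tree_aut_group :: "(bool list \<Rightarrow> bool list) monoid" where
  "tree_aut_group = \<lparr>carrier = {f. tree_automorphism f}, mult = (\<circ>), one = id\<rparr>"

datatype letter = La | Lb | Lc | Ld

fun act :: "letter \<Rightarrow> bool list \<Rightarrow> bool list" where
  "act g [] = []"
| "act La (False # u) = True # u"
| "act La (True # u) = False # u"
| "act Lb (False # u) = False # act La u"
| "act Lb (True # u) = True # act Lc u"
| "act Lc (False # u) = False # act La u"
| "act Lc (True # u) = True # act Ld u"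
| "act Ld (False # u) = False # u"
| "act Ld (True # u) = True # act Lb u"

definition grigorchuk_group :: "(bool list \<Rightarrow> bool list) monoid" where
  "grigorchuk_group = subgroup_generated tree_aut_group (range act)"

lemma act_involution: "act g (act g u) = u"
  by (induction g u rule: act.induct) simp_all

lemma length_act: "length (act g u) = length u"
  by (induction g u rule: act.induct) simp_all

lemma act_snoc: "\<exists>y. act g (u @ [x]) = act g u @ [y]"
proof (induction g u rule: act.induct)
  case (1 g)
  show ?case by (cases g; cases x) auto
qed simp_all

lemma child_act: "child u v \<Longrightarrow> child (act g u) (act g v)"
  using act_snoc by (auto simp: child_def)

lemma tree_automorphism_act: "tree_automorphism (act g)"
proof -
  have "bij (act g)"
    by (rule o_bij[of "act g"]) (auto simp: act_involution)
  moreover have "child (act g u) (act g v) \<longleftrightarrow> child u v" for u v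
    using child_act[of u v g] child_act[of "act g u" "act g v" g]
    by (auto simp: act_involution)
  ultimately show ?thesis
    by (simp add: tree_automorphism_def)
qed

lemma group_tree_aut_group: "group tree_aut_group"
proof (rule groupI)
  fix f assume "f \<in> carrier tree_aut_group"
  then have f: "bij f" "f [] = []" "\<And>u v. child (f u) (f v) \<longleftrightarrow> child u v"
    by (auto simp: tree_aut_group_def tree_automorphism_def)
  define k where "k = inv_into UNIV f"
  have kf: "k \<circ> f = id" "\<And>u. f (k u) = u"
    using f(1) by (auto simp: k_def bij_is_inj bij_is_surj surj_f_inv_f)
  have "bij (k)"
    unfolding k_def using f(1) by (rule bij_imp_bij_inv)
  moreover have "k [] = []"
    using f(2) kf(1) by (metis comp_apply id_apply)
  moreover have "child (k u) (k v) \<longleftrightarrow> child u v" for u v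
    using f(3)[of "k u" "k v"] by (simp add: kf)
  ultimately show "\<exists>g\<in>carrier tree_aut_group. g \<otimes>\<^bsub>tree_aut_group\<^esub> f = \<one>\<^bsub>tree_aut_group\<^esub>"
    using kf by (intro bexI[of _ k]) (auto simp: tree_aut_group_def tree_automorphism_def)
qed (auto simp: tree_aut_group_def tree_automorphism_def bij_comp)

lemma group_grigorchuk_group: "group grigorchuk_group"
  unfolding grigorchuk_group_def
  by (rule group.group_subgroup_generated[OF group_tree_aut_group])

lemma act_in_grigorchuk_group: "act g \<in> carrier grigorchuk_group"
  unfolding grigorchuk_group_def carrier_subgroup_generated
  by (rule generate.incl) (auto simp: tree_aut_group_def tree_automorphism_act)


section \<open>Co-word problem\<close>

text \<open>
  For permutation groups such as the one above, products are composed as functions. Acting from the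
  right instead would evaluate the reversed word; since the generators of Grigorchuk's group are
  involutions, this does not change which words are trivial.
\<close>

definition word_value :: "('g, 'm) monoid_scheme \<Rightarrow> ('a \<Rightarrow> 'g) \<Rightarrow> 'a list \<Rightarrow> 'g" where
  "word_value G \<phi> w = foldr (\<lambda>x g. \<phi> x \<otimes>\<^bsub>G\<^esub> g) w \<one>\<^bsub>G\<^esub>"

definition coword_problem :: "('g, 'm) monoid_scheme \<Rightarrow> ('a \<Rightarrow> 'g) \<Rightarrow> 'a set \<Rightarrow> 'a list set" where
  "coword_problem G \<phi> A = {w \<in> lists A. word_value G \<phi> w \<noteq> \<one>\<^bsub>G\<^esub>}"

end

theory Submission imports Defs begin

text \<open>
  Read a word \<open>w\<close> from left to right while its letters act on a vertex \<open>s # u\<close> of the tree. Each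
  letter changes the first entry \<open>s\<close> (only \<open>a\<close> does) and passes at most one letter on to the
  subtree below; the letters passed on form the section \<open>section_word s w\<close>. Hence \<open>w\<close> is
  non-trivial iff repeated passage to sections leads to a word with an odd number of letters \<open>a\<close>
  (\<open>moves_iff\<close>). The grammar runs this backwards: it starts with any word with an odd number of
  letters \<open>a\<close>, replaces the current word \<open>w'\<close> by an arbitrary word that has \<open>w'\<close> as a section,
  and repeats this any number of times.

  To invert a section, every letter of \<open>w'\<close> is replaced by a letter that it may come from, and
  between these letters go silent words, which pass nothing on. A silent word must bring the first
  entry of the vertex from its value at the letter before to its value at the letter after.
  A table rewrites each letter without seeing the others, so agreement between
  neighbours is the difficulty. Two features of Grigorchuk's group remove it. First, a letter
  passed on reveals where it was passed on: \<open>a\<close> comes only from below 0, the others only from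
  below 1. So one bit per letter, whether the next letter is \<open>a\<close>, says where the next silent
  word has to end. Secondly, a letter that passes something on is never \<open>a\<close>. So this bit
  stays predictable after the replacement: at the end of a silent word, the next letter is not \<open>a\<close>,
  whichever preimage is chosen there.

  Words are therefore held as lists of symbols that carry a letter and such a bit, with a symbol
  for the left end of the word so that a silent word can also be put in front. One table, \<open>lift\<close>,
  replaces all letters and opens the gaps behind them; a second, \<open>grow\<close>, fills gaps letter by
  letter; a third, \<open>finish\<close>, produces terminals. The tables may be applied in any order, since
  lifting or finishing a word with an open gap produces a dead symbol that nothing removes.
  The lemmas \<open>lift_complete\<close> and \<open>lift_sound\<close> say that lifting and then growing inverts sections
  exactly; \<open>sound_step\<close> is the invariant for arbitrary orders of the tables, and \<open>ET0L_derives\<close>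
  turns the system into an ET0L grammar.
\<close>

section \<open>ET0L languages from rewriting over a finite type\<close>

definition par_step :: "('c \<Rightarrow> 'c list set) \<Rightarrow> 'c list \<Rightarrow> 'c list \<Rightarrow> bool" where
  "par_step R u v \<longleftrightarrow> (\<exists>vs. v = concat vs \<and> list_all2 (\<lambda>c w. w \<in> R c) u vs)"

definition derives :: "('c \<Rightarrow> 'c list set) set \<Rightarrow> 'c list \<Rightarrow> 'c list \<Rightarrow> bool" where
  "derives \<Phi> = (\<lambda>u v. \<exists>R\<in>\<Phi>. par_step R u v)\<^sup>*\<^sup>*"

lemma par_step_Nil [simp]: "par_step R [] v \<longleftrightarrow> v = []"
  by (auto simp: par_step_def)

lemma par_step_Cons:
  "par_step R (c # u) v \<longleftrightarrow> (\<exists>w v'. w \<in> R c \<and> par_step R u v' \<and> v = w @ v')"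
proof -
  have "par_step R (c # u) v \<longleftrightarrow>
      (\<exists>w vs. v = w @ concat vs \<and> w \<in> R c \<and> list_all2 (\<lambda>c w. w \<in> R c) u vs)"
    unfolding par_step_def list_all2_Cons1 by (metis (no_types, lifting) concat.simps(2))
  then show ?thesis
    unfolding par_step_def by blast
qed

lemma par_step_append:
  "par_step R (u @ u') v \<longleftrightarrow> (\<exists>w w'. par_step R u w \<and> par_step R u' w' \<and> v = w @ w')"
  by (induction u arbitrary: v) (fastforce simp: par_step_Cons)+

lemma par_step_refl: "(\<And>c. c \<in> set u \<Longrightarrow> [c] \<in> R c) \<Longrightarrow> par_step R u u"
  by (induction u) (force simp: par_step_Cons)+

lemma derives_refl: "derives \<Phi> u u"
  by (simp add: derives_def)

lemma derives_trans: "derives \<Phi> u v \<Longrightarrow> derives \<Phi> v w \<Longrightarrow> derives \<Phi> u w"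
  by (auto simp: derives_def)

lemma derives_step: "R \<in> \<Phi> \<Longrightarrow> par_step R u v \<Longrightarrow> derives \<Phi> u v"
  by (auto simp: derives_def)

lemma derives_mono: "\<Phi> \<subseteq> \<Psi> \<Longrightarrow> derives \<Phi> u v \<Longrightarrow> derives \<Psi> u v"
  unfolding derives_def by (erule rtranclp_mono[THEN predicate2D, rotated]) blast

text \<open>
  The two parts need not be derived in equally many steps: each can wait, by copying its
  symbols, while the other is rewritten.
\<close>

lemma derives_append:
  assumes "derives {R} u u'" "derives {R} v v'" and copy: "\<And>c. [c] \<in> R c"
  shows "derives {R} (u @ v) (u' @ v')"
proof -
  have "derives {R} (u @ v) (u' @ v)"
    using assms(1) unfolding derives_def
  proof induction
    case (step x y)
    then have "par_step R (x @ v) (y @ v)"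
      using par_step_refl[OF copy] by (auto simp: par_step_append)
    then show ?case
      using step.IH by (auto intro: rtranclp.rtrancl_into_rtrancl)
  qed simp
  moreover have "derives {R} (u' @ v) (u' @ v')"
    using assms(2) unfolding derives_def
  proof induction
    case (step x y)
    then have "par_step R (u' @ x) (u' @ y)"
      using par_step_refl[OF copy] by (auto simp: par_step_append)
    then show ?case
      using step.IH by (auto intro: rtranclp.rtrancl_into_rtrancl)
  qed simp
  ultimately show ?thesis
    by (rule derives_trans)
qed

lemma table_steps_iff_rtranclp:
  "(\<exists>r\<in>lists H. table_steps C r u v) \<longleftrightarrow> (\<lambda>u v. \<exists>h\<in>H. table_step C h u v)\<^sup>*\<^sup>* u v"
proof
  assume "\<exists>r\<in>lists H. table_steps C r u v"
  then obtain r where "r \<in> lists H" "table_steps C r u v" by blast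
  then show "(\<lambda>u v. \<exists>h\<in>H. table_step C h u v)\<^sup>*\<^sup>* u v"
    by (induction r arbitrary: u) (auto intro: converse_rtranclp_into_rtranclp)
next
  assume "(\<lambda>u v. \<exists>h\<in>H. table_step C h u v)\<^sup>*\<^sup>* u v"
  then show "\<exists>r\<in>lists H. table_steps C r u v"
  proof (induction rule: converse_rtranclp_induct)
    case base
    show ?case by (intro bexI[of _ "[]"]) auto
  next
    case (step u u')
    then obtain h r where "h \<in> H" "table_step C h u u'" "r \<in> lists H" "table_steps C r u' v"
      by blast
    then show ?case by (intro bexI[of _ "h # r"]) auto
  qed
qed

text \<open>
  The control language of all words: the system built below needs no restriction on the order
  of its tables.
\<close>

lemma regular_lang_lists: "regular_lang H (lists H)"
proof -
  have "foldl (\<lambda>_ _. 0) (0 :: nat) r = 0" for r :: "'a list"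
    by (induction r) auto
  then show ?thesis
    unfolding regular_lang_def
    by (intro exI[of _ "{0}"] exI[of _ "\<lambda>_ _. 0"] exI[of _ 0]) auto
qed

definition coded_table :: "('c \<Rightarrow> 'd) \<Rightarrow> ('c \<Rightarrow> 'c list set) \<Rightarrow> 'd table" where
  "coded_table k R = {(k c, map k v) |c v. v \<in> R c}"

lemma table_step_coded_table:
  assumes "inj k" and total: "\<And>c. R c \<noteq> {}"
  shows "table_step (range k) (coded_table k R) (map k u) v' \<longleftrightarrow>
    (\<exists>v. v' = map k v \<and> par_step R u v)"
proof -
  have "completed (range k) (coded_table k R) = coded_table k R"
    using total by (fastforce simp: completed_def coded_table_def)
  then have step: "table_step (range k) (coded_table k R) u' v' \<longleftrightarrow>
      par_step (\<lambda>c. {w. (c, w) \<in> coded_table k R}) u' v'" for u' v'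
    by (simp add: table_step_def par_step_def)
  have rule: "(k c, w) \<in> coded_table k R \<longleftrightarrow> (\<exists>v. w = map k v \<and> v \<in> R c)" for c w
    using \<open>inj k\<close> by (auto simp: coded_table_def inj_eq)
  show ?thesis
    unfolding step
  proof (induction u arbitrary: v')
    case (Cons c u)
    have "par_step (\<lambda>c. {w. (c, w) \<in> coded_table k R}) (map k (c # u)) v' \<longleftrightarrow>
        (\<exists>w v. w \<in> R c \<and> par_step R u v \<and> v' = map k w @ map k v)"
      by (auto simp: par_step_Cons rule Cons.IH)
    also have "\<dots> \<longleftrightarrow> (\<exists>v. v' = map k v \<and> par_step R (c # u) v)"
      unfolding par_step_Cons map_append[symmetric] by blast
    finally show ?case .
  qed simp
qed

text \<open>
  Grammars may be given over any finite type of symbols, by rules that are total. Totality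
  matters because a table copies a letter without a rule, so that an empty set of rules would not
  block a derivation.
\<close>

lemma ET0L_derives:
  fixes \<Phi> :: "('c::finite \<Rightarrow> 'c list set) set" and T :: "'a \<Rightarrow> 'c"
  assumes T: "inj_on T A" and "finite \<Phi>"
    and fin: "\<And>R c. R \<in> \<Phi> \<Longrightarrow> finite (R c)"
    and total: "\<And>R c. R \<in> \<Phi> \<Longrightarrow> R c \<noteq> {}"
  shows "ET0L A {w \<in> lists A. derives \<Phi> [s] (map T w)}"
proof -
  obtain f :: "'c \<Rightarrow> nat" where f: "inj f"
    using finite_imp_inj_to_nat_seg[of "UNIV :: 'c set"] by auto
  \<comment> \<open>Terminals have to be coded by \<open>Inl\<close>; any injection into the naturals serves for the rest.\<close>
  define k where "k c = (if c \<in> T ` A then Inl (inv_into A T c) else Inr (f c))" for c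
  have k: "inj k"
    using f by (auto simp: k_def inj_on_def dest: inv_into_injective split: if_splits)
  have kT: "k (T x) = Inl x" if "x \<in> A" for x
    using that T by (simp add: k_def)
  let ?C = "range k" and ?H = "coded_table k ` \<Phi>"
  have coded: "table_step ?C (coded_table k R) (map k u) v' \<longleftrightarrow>
      (\<exists>v. v' = map k v \<and> par_step R u v)" if "R \<in> \<Phi>" for R u v'
    using table_step_coded_table[OF k] total[OF that] by blast
  have steps: "(\<lambda>u v. \<exists>h\<in>?H. table_step ?C h u v)\<^sup>*\<^sup>* (map k u) v' \<longleftrightarrow>
      (\<exists>v. v' = map k v \<and> derives \<Phi> u v)" for u v'
  proof
    assume "(\<lambda>u v. \<exists>h\<in>?H. table_step ?C h u v)\<^sup>*\<^sup>* (map k u) v'"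
    then show "\<exists>v. v' = map k v \<and> derives \<Phi> u v"
    proof (induction rule: rtranclp_induct)
      case base
      show ?case using derives_refl by blast
    next
      case (step x y)
      then obtain v R where v: "x = map k v" "derives \<Phi> u v" and "R \<in> \<Phi>"
        and "table_step ?C (coded_table k R) x y" by blast
      then obtain v' where "y = map k v'" "par_step R v v'"
        using coded by blast
      then show ?case
        using v \<open>R \<in> \<Phi>\<close> derives_trans derives_step by blast
    qed
  next
    assume "\<exists>v. v' = map k v \<and> derives \<Phi> u v"
    then obtain v where v': "v' = map k v" and "derives \<Phi> u v" by blast
    from this(2) show "(\<lambda>u v. \<exists>h\<in>?H. table_step ?C h u v)\<^sup>*\<^sup>* (map k u) v'"
      unfolding v' derives_def
    proof (induction rule: rtranclp_induct)
      case (step x y)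
      then have "\<exists>h\<in>?H. table_step ?C h (map k x) (map k y)"
        using coded by auto
      then show ?case using step.IH by (auto intro: rtranclp.rtrancl_into_rtrancl)
    qed simp
  qed
  have "derives \<Phi> [s] (map T w) \<longleftrightarrow> (\<exists>r\<in>lists ?H. table_steps ?C r [k s] (map Inl w))"
    if "w \<in> lists A" for w
  proof -
    have w: "map Inl w = map k (map T w)"
      using that kT by auto
    have "(\<exists>r\<in>lists ?H. table_steps ?C r (map k [s]) (map k (map T w))) \<longleftrightarrow>
        derives \<Phi> [s] (map T w)"
      unfolding table_steps_iff_rtranclp steps inj_map_eq_map[OF k] by blast
    then show ?thesis by (simp only: w list.map)
  qed
  moreover have "finite (coded_table k R)" if "R \<in> \<Phi>" for R
  proof -
    have "coded_table k R = (\<Union>c. (\<lambda>v. (k c, map k v)) ` R c)"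
      by (auto simp: coded_table_def)
    then show ?thesis using fin[OF that] by simp
  qed
  then have "\<forall>h\<in>?H. is_table ?C h"
    by (auto simp: is_table_def coded_table_def)
  moreover have "Inl ` A \<subseteq> ?C"
    using kT by (metis image_subsetI rangeI)
  ultimately show ?thesis
    unfolding ET0L_def using \<open>finite \<Phi>\<close> regular_lang_lists[of ?H]
    by (intro exI[of _ ?C] exI[of _ ?H] exI[of _ "lists ?H"] exI[of _ "k s"]) auto
qed


section \<open>Sections of words\<close>

text \<open>
  The letter that a generator passes on to the subtree below the child \<open>s\<close>, with \<open>None\<close> if
  it acts trivially there.
\<close>

fun sec :: "bool \<Rightarrow> letter \<Rightarrow> letter option" where
  "sec s La = None"
| "sec False Lb = Some La"
| "sec True Lb = Some Lc"
| "sec False Lc = Some La"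
| "sec True Lc = Some Ld"
| "sec False Ld = None"
| "sec True Ld = Some Lb"

text \<open>
  The child of the root to which \<open>s\<close> is moved when the letters of the word act one after another,
  the leftmost first.
\<close>

fun turn :: "bool \<Rightarrow> letter list \<Rightarrow> bool" where
  "turn s [] = s"
| "turn s (x # w) = turn (s \<noteq> (x = La)) w"

fun section_word :: "bool \<Rightarrow> letter list \<Rightarrow> letter list" where
  "section_word s [] = []"
| "section_word s (x # w) =
     (case sec s x of None \<Rightarrow> [] | Some y \<Rightarrow> [y]) @ section_word (s \<noteq> (x = La)) w"

text \<open>
  The two features that make sections invertible by context-free rules: a letter \<open>x\<close> that is
  passed on determines the child below which this happens, and only letters other than \<open>a\<close>,
  which leave the child in place, pass anything on.
\<close>

lemma sec_eq_Some: "sec s z = Some x \<Longrightarrow> s = (x \<noteq> La) \<and> z \<noteq> La"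
  by (cases "(s, z)" rule: sec.cases) auto

lemma act_Cons: "act x (s # u) = (s \<noteq> (x = La)) # (case sec s x of None \<Rightarrow> u | Some y \<Rightarrow> act y u)"
  by (cases x; cases s) auto

lemma section_word_append: "section_word s (u @ v) = section_word s u @ section_word (turn s u) v"
  by (induction u arbitrary: s) auto

lemma fold_act_Cons: "fold act w (s # u) = turn s w # fold act (section_word s w) u"
  by (induction w arbitrary: s u) (auto simp: act_Cons split: option.splits)

lemma turn_flip: "turn (\<not> s) w \<longleftrightarrow> \<not> turn s w"
proof (induction w arbitrary: s)
  case (Cons x w)
  then show ?case by (cases "x = La") simp_all
qed simp

lemma turn_neq_iff: "turn s w \<noteq> s \<longleftrightarrow> turn False w"
  using turn_flip[of False w] by (cases s) auto

inductive moves :: "letter list \<Rightarrow> bool" where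
  turns: "turn False w \<Longrightarrow> moves w"
| section_moves: "moves (section_word s w) \<Longrightarrow> moves w"

text \<open>
  A vertex moved by \<open>w\<close> either changes in its first entry, which is decided by the parity of the
  number of letters \<open>a\<close>, or its remainder is moved by a section. The length of a moved vertex
  bounds the number of sections that have to be taken.
\<close>

lemma moves_iff: "moves w \<longleftrightarrow> (\<exists>v. fold act w v \<noteq> v)"
proof
  show "\<exists>v. fold act w v \<noteq> v" if "moves w"
    using that
  proof induction
    case (turns w)
    then have "fold act w [False] \<noteq> [False]"
      by (simp add: fold_act_Cons)
    then show ?case ..
  next
    case (section_moves s w)
    then show ?case by (metis fold_act_Cons list.inject)
  qed
next
  assume "\<exists>v. fold act w v \<noteq> v"
  then obtain v where "fold act w v \<noteq> v" ..
  then show "moves w"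
  proof (induction v arbitrary: w)
    case Nil
    have "fold act w [] = []" by (induction w) auto
    with Nil show ?case by simp
  next
    case (Cons s u)
    then have "turn s w \<noteq> s \<or> fold act (section_word s w) u \<noteq> u"
      by (simp add: fold_act_Cons)
    then show ?case
      using Cons.IH turn_neq_iff moves.intros by blast
  qed
qed

lemma one_grigorchuk_group: "\<one>\<^bsub>grigorchuk_group\<^esub> = id"
  by (simp add: grigorchuk_group_def tree_aut_group_def subgroup_generated_def)

lemma word_value_grigorchuk: "word_value grigorchuk_group act w = foldr act w"
proof -
  have "word_value grigorchuk_group act w = foldr (\<lambda>x g. act x \<circ> g) w id"
    by (simp add: word_value_def grigorchuk_group_def tree_aut_group_def subgroup_generated_def)
  also have "\<dots> = foldr act w"
    by (induction w) auto
  finally show ?thesis .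
qed

text \<open>
  The value of a word as a product of functions applies the rightmost letter first, whereas
  sections are taken here from the left. The two orders give mutually inverse permutations because
  the generators are involutions, and so the same non-trivial words.
\<close>

lemma coword_problem_grigorchuk:
  "coword_problem grigorchuk_group act {La, Lb, Lc, Ld} = {w. moves w}"
proof -
  have "fold act w (foldr act w v) = v" and "foldr act w (fold act w v) = v" for w v
    by (induction w arbitrary: v) (auto simp: act_involution)
  then have "foldr act w \<noteq> id \<longleftrightarrow> (\<exists>v. fold act w v \<noteq> v)" for w
    by (metis eq_id_iff)
  moreover have "lists {La, Lb, Lc, Ld} = UNIV"
    using letter.exhaust by auto
  ultimately show ?thesis
    by (simp add: coword_problem_def word_value_grigorchuk moves_iff one_grigorchuk_group)
qed


section \<open>The rewriting system\<close>

text \<open>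
  What remains to be filled into a gap. \<open>Odd s\<close> asks for a word that leads from \<open>s\<close> to \<open>True\<close> and
  serves for the words with an odd number of letters \<open>a\<close>. \<open>Silent s (Some t)\<close> asks for
  a word with empty section that leads from \<open>s\<close> to \<open>t\<close>; with \<open>None\<close> the gap is the last one, and
  every end point will do.
\<close>

datatype goal = Odd bool | Silent bool "bool option"

text \<open>
  The argument of type \<^typ>\<open>letter option\<close> is a letter of the current word, or \<open>None\<close> for the mark
  at its left end. The second argument of \<open>Settled\<close> tells about the next letter: \<open>None\<close> if there
  is none, \<open>Some False\<close> if it is \<open>a\<close>, and \<open>Some True\<close> otherwise. Equivalently, by \<open>sec_eq_Some\<close>,
  it is the child below which the next letter would have been passed on. In \<open>Open y q\<close> the gap
  behind the letter \<open>y\<close> is still to be filled.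
\<close>

datatype sym =
    Term letter
  | Settled "letter option" "bool option"
  | Open "letter option" goal
  | Dead

instance letter :: finite
proof
  have "(UNIV :: letter set) = {La, Lb, Lc, Ld}"
    using letter.exhaust by auto
  then show "finite (UNIV :: letter set)" by (metis finite.emptyI finite.insertI)
qed

instance goal :: finite
proof
  have "x \<in> range Odd \<union> range (case_prod Silent)" for x
    by (cases x) force+
  then have "(UNIV :: goal set) = range Odd \<union> range (case_prod Silent)"
    by blast
  then show "finite (UNIV :: goal set)" by (metis finite finite_Un finite_imageI)
qed

instance sym :: finite
proof
  have "x \<in> range Term \<union> range (case_prod Settled) \<union> range (case_prod Open) \<union> {Dead}" for x
    by (cases x) force+
  then have "(UNIV :: sym set) =
      range Term \<union> range (case_prod Settled) \<union> range (case_prod Open) \<union> {Dead}"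
    by blast
  then show "finite (UNIV :: sym set)"
    by (metis finite finite.emptyI finite.insertI finite_Un finite_imageI)
qed

text \<open>
  The symbols that hold the word \<open>w\<close> with the letter \<open>y\<close> in front of it, if \<open>n\<close> describes what
  follows after \<open>w\<close>.
\<close>

fun settle :: "letter option \<Rightarrow> letter list \<Rightarrow> bool option \<Rightarrow> sym list" where
  "settle y [] n = [Settled y n]"
| "settle y (x # w) n = Settled y (Some (x \<noteq> La)) # settle (Some x) w n"

fun advance :: "goal \<Rightarrow> letter \<Rightarrow> goal option" where
  "advance (Odd s) x = Some (Odd (s \<noteq> (x = La)))"
| "advance (Silent s m) x = (if sec s x = None then Some (Silent (s \<noteq> (x = La)) m) else None)"

text \<open>
  The word \<open>u\<close> may fill a gap, and \<open>n\<close> is then what the last symbol has to know about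
  the letter after the gap. In an inner gap this is \<open>Some True\<close>, as the letter after it has just
  been lifted and so is not \<open>a\<close>.
\<close>

fun fits :: "goal \<Rightarrow> letter list \<Rightarrow> bool option \<Rightarrow> bool" where
  "fits (Odd s) u n \<longleftrightarrow> turn s u \<and> n = None"
| "fits (Silent s None) u n \<longleftrightarrow> section_word s u = [] \<and> n = None"
| "fits (Silent s (Some t)) u n \<longleftrightarrow> section_word s u = [] \<and> turn s u = t \<and> n = Some True"

text \<open>
  The bit \<open>n\<close> about the next letter of the old word becomes the goal of the gap. A lifted letter is
  not \<open>a\<close>, so the gap behind it starts at the child \<open>s\<close> at which the letter was passed
  on; the gap behind the left end may start anywhere.
\<close>

fun lift :: "sym \<Rightarrow> sym list set" where
  "lift (Term x) = {[Term x]}"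
| "lift (Settled None n) = {[Open None (Silent s n)] |s. True}"
| "lift (Settled (Some x) n) = {[Open (Some z) (Silent s n)] |z s. sec s z = Some x}"
| "lift _ = {[Dead]}"

fun grow :: "sym \<Rightarrow> sym list set" where
  "grow (Open y q) = {[Open y q]} \<union> {[Settled y n] |n. fits q [] n} \<union>
     {[Settled y (Some (x \<noteq> La)), Open (Some x) q'] |x q'. advance q x = Some q'}"
| "grow c = {[c]}"

fun finish :: "sym \<Rightarrow> sym list set" where
  "finish (Term x) = {[Term x]}"
| "finish (Settled None n) = {[]}"
| "finish (Settled (Some x) n) = {[Term x]}"
| "finish _ = {[Dead]}"

text \<open>
  The lists without gaps that a symbol can grow into. A dead symbol has none, so that a list which
  contains one has no outcome at all.
\<close>

fun outcomes :: "sym \<Rightarrow> sym list set" where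
  "outcomes (Open y q) = {settle y u n |u n. fits q u n}"
| "outcomes Dead = {}"
| "outcomes c = {[c]}"

lemma fits_Cons: "fits q (x # u) n \<longleftrightarrow> (\<exists>q'. advance q x = Some q' \<and> fits q' u n)"
proof (cases q)
  case (Silent s m)
  then show ?thesis by (cases m) (auto split: option.splits)
qed simp

lemma settle_append:
  "settle y (u @ z # w) n = settle y u (Some (z \<noteq> La)) @ settle (Some z) w n"
  by (induction u arbitrary: y) auto

lemma finite_lift: "finite (lift c)"
proof (cases c rule: lift.cases)
  case (3 x n)
  have "lift c \<subseteq> (\<lambda>(z, s). [Open (Some z) (Silent s n)]) ` UNIV"
    using 3 by auto
  then show ?thesis by (rule finite_subset) simp
qed (auto simp: full_SetCompr_eq)

lemma finite_grow: "finite (grow c)"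
proof (cases c)
  case (Open y q)
  have "grow c \<subseteq> {[Open y q]} \<union> range (\<lambda>n. [Settled y n]) \<union>
      (\<lambda>(x, q'). [Settled y (Some (x \<noteq> La)), Open (Some x) q']) ` UNIV"
    using Open by auto
  then show ?thesis by (rule finite_subset) simp
qed auto

lemma finite_finish: "finite (finish c)"
  by (cases c rule: finish.cases) auto

lemma ex_sec: "\<exists>z s. sec s z = Some x"
  using sec.simps by (cases x) blast+

lemma lift_nonempty: "lift c \<noteq> {}"
  using ex_sec by (cases c rule: lift.cases) auto

lemma grow_copy: "[c] \<in> grow c"
  by (cases c) auto

lemma grow_nonempty: "grow c \<noteq> {}"
  using grow_copy by blast

lemma finish_nonempty: "finish c \<noteq> {}"
  by (cases c rule: finish.cases) auto


section \<open>Growing\<close>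

lemma grow_outcome: "G \<in> outcomes c \<Longrightarrow> derives {grow} [c] G"
proof (cases c)
  case (Open y q)
  assume "G \<in> outcomes c"
  then obtain u n where "fits q u n" and G: "G = settle y u n"
    using Open by auto
  then have "derives {grow} [Open y q] (settle y u n)"
  proof (induction u arbitrary: y q G)
    case Nil
    then show ?case by (intro derives_step) (auto simp: par_step_Cons)
  next
    case (Cons x u)
    then obtain q' where q': "advance q x = Some q'" "fits q' u n"
      by (auto simp: fits_Cons)
    have "derives {grow} [Open y q] ([Settled y (Some (x \<noteq> La))] @ [Open (Some x) q'])"
      using q' by (intro derives_step) (auto simp: par_step_Cons)
    moreover have "derives {grow} ([Settled y (Some (x \<noteq> La))] @ [Open (Some x) q'])
        ([Settled y (Some (x \<noteq> La))] @ settle (Some x) u n)"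
      using Cons.IH q' by (intro derives_append derives_refl grow_copy) auto
    ultimately show ?case
      using derives_trans by fastforce
  qed
  then show ?thesis using Open G by simp
qed (auto simp: derives_refl)

lemma grow_outcomes: "par_step outcomes F G \<Longrightarrow> derives {grow} F G"
proof (induction F arbitrary: G)
  case (Cons c F)
  then obtain w v where "w \<in> outcomes c" "par_step outcomes F v" "G = w @ v"
    by (auto simp: par_step_Cons)
  then show ?case
    using derives_append[of grow "[c]" w F v] grow_outcome Cons.IH grow_copy by simp
qed (simp add: derives_refl)

lemma outcomes_grow:
  assumes "v \<in> grow c" "par_step outcomes v G"
  shows "G \<in> outcomes c"
proof (cases c)
  case (Open y q)
  with assms(1) consider "v = [Open y q]" | n where "v = [Settled y n]" "fits q [] n"
    | x q' where "v = [Settled y (Some (x \<noteq> La)), Open (Some x) q']" "advance q x = Some q'"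
    by auto
  then show ?thesis
  proof cases
    case 2
    with assms(2) have "G = settle y [] n" by (auto simp: par_step_Cons)
    with 2 show ?thesis unfolding Open outcomes.simps by blast
  next
    case 3
    with assms(2) obtain u n where "fits q' u n" and G: "G = settle y (x # u) n"
      by (auto simp: par_step_Cons)
    with 3 have "fits q (x # u) n" by (auto simp: fits_Cons)
    then show ?thesis unfolding Open G outcomes.simps by blast
  qed (use assms Open in \<open>auto simp: par_step_Cons\<close>)
qed (use assms in \<open>auto simp: par_step_Cons\<close>)

lemma par_step_grow_outcomes:
  "par_step grow F F' \<Longrightarrow> par_step outcomes F' G \<Longrightarrow> par_step outcomes F G"
proof (induction F arbitrary: F' G)
  case (Cons c F)
  then show ?case
    using outcomes_grow by (fastforce simp: par_step_Cons par_step_append)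
qed simp


section \<open>Lifting\<close>

text \<open>
  Every word \<open>w\<close> with section \<open>w'\<close> can be regained from \<open>w'\<close>. For the induction on \<open>w\<close>, the
  first symbol is not lifted but replaced by an open gap behind an arbitrary letter
  \<open>y\<close> from an arbitrary child \<open>s\<close>: this is the situation in the middle of \<open>w\<close>. A silent letter is
  put into that gap; a letter that passes something on closes it.
\<close>

lemma lift_complete:
  "section_word s w = w' \<Longrightarrow> \<exists>n F. hd (settle y' w' None) = Settled y' n \<and>
     par_step lift (tl (settle y' w' None)) F \<and>
     par_step outcomes (Open y (Silent s n) # F) (settle y w None)"
proof (induction w arbitrary: s y y' w')
  case Nil
  have "par_step outcomes [Open y (Silent s None)] (settle y [] None)"
    by (auto simp: par_step_Cons intro!: exI[of _ "[]"])
  with Nil show ?case by auto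
next
  case (Cons x w)
  show ?case
  proof (cases "sec s x")
    case None
    let ?s = "s \<noteq> (x = La)"
    from None Cons.prems have "section_word ?s w = w'" by simp
    from Cons.IH[OF this, of y' "Some x"] obtain n F where
      "hd (settle y' w' None) = Settled y' n" "par_step lift (tl (settle y' w' None)) F"
      and out: "par_step outcomes (Open (Some x) (Silent ?s n) # F) (settle (Some x) w None)"
      by blast
    moreover obtain u m v where u: "fits (Silent ?s n) u m" "par_step outcomes F v"
      "settle (Some x) w None = settle (Some x) u m @ v"
      using out by (auto simp: par_step_Cons)
    then have "fits (Silent s n) (x # u) m"
      using None by (auto simp: fits_Cons)
    moreover have "settle y (x # w) None = settle y (x # u) m @ v"
      using u by simp
    ultimately show ?thesis
      using u by (auto simp: par_step_Cons simp del: settle.simps)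
  next
    case (Some x')
    then have x: "s = (x' \<noteq> La)" "x \<noteq> La" by (auto dest: sec_eq_Some)
    with Some Cons.prems have w': "w' = x' # section_word s w" by simp
    let ?v = "settle (Some x') (section_word s w) None"
    from Cons.IH[OF refl, of "Some x'" s "Some x"] obtain n F where
      F: "hd ?v = Settled (Some x') n" "par_step lift (tl ?v) F"
        "par_step outcomes (Open (Some x) (Silent s n) # F) (settle (Some x) w None)"
      by blast
    have "?v = Settled (Some x') n # tl ?v"
      using F(1) by (cases "section_word s w") auto
    moreover have "[Open (Some x) (Silent s n)] \<in> lift (Settled (Some x') n)"
      using Some by auto
    ultimately have "par_step lift ?v (Open (Some x) (Silent s n) # F)"
      using F(2) by (metis par_step_Cons append_Cons append_Nil)
    moreover have "[Settled y (Some True)] \<in> outcomes (Open y (Silent s (Some (x' \<noteq> La))))"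
      using x by (auto intro!: exI[of _ "[]"])
    then have "par_step outcomes (Open y (Silent s (Some (x' \<noteq> La))) # Open (Some x) (Silent s n) # F)
        (settle y (x # w) None)"
      using F(3) x by (subst par_step_Cons) fastforce
    ultimately show ?thesis
      by (auto simp: w')
  qed
qed

text \<open>
  Conversely only such words are obtained. The induction is on \<open>w'\<close>: a first silent word \<open>u\<close> ends
  at the child recorded for the next letter \<open>x\<close> of \<open>w'\<close>, and by \<open>sec_eq_Some\<close> this is the child at
  which the lifted letter \<open>z\<close> passes on \<open>x\<close>, whichever preimage \<open>z\<close> of \<open>x\<close> was chosen.
\<close>

lemma lift_sound:
  assumes "hd (settle y' w' None) = Settled y' n" "par_step lift (tl (settle y' w' None)) F"
    "par_step outcomes (Open y (Silent s n) # F) G"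
  shows "\<exists>w. G = settle y w None \<and> section_word s w = w'"
  using assms
proof (induction w' arbitrary: y' n F y s G)
  case Nil
  then show ?case by (auto simp: par_step_Cons)
next
  case (Cons x w')
  let ?v = "settle (Some x) w' None"
  obtain m where v: "?v = Settled (Some x) m # tl ?v"
    by (cases w') auto
  have n: "n = Some (x \<noteq> La)" using Cons.prems(1) by simp
  have "par_step lift (Settled (Some x) m # tl ?v) F"
    using Cons.prems(2) v by simp
  then obtain z s' F' where z: "sec s' z = Some x" and F': "par_step lift (tl ?v) F'"
    and F: "F = Open (Some z) (Silent s' m) # F'"
    by (auto simp: par_step_Cons)
  from sec_eq_Some[OF z] have s': "s' = (x \<noteq> La)" "z \<noteq> La" by auto
  obtain u G' where u: "section_word s u = []" "turn s u = (x \<noteq> La)"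
    and G': "par_step outcomes F G'" and G: "G = settle y u (Some True) @ G'"
    using Cons.prems(3) unfolding n par_step_Cons by auto
  have "hd ?v = Settled (Some x) m" using v by (metis list.sel(1))
  from Cons.IH[OF this F' G'[unfolded F]] obtain w where
    w: "G' = settle (Some z) w None" "section_word s' w = w'" by blast
  have "G = settle y (u @ z # w) None"
    using s' by (simp add: settle_append G w)
  moreover have "section_word s (u @ z # w) = x # w'"
    using u s' z w by (auto simp: section_word_append)
  ultimately show ?case by blast
qed


section \<open>The language of the system\<close>

abbreviation tables :: "(sym \<Rightarrow> sym list set) set" where
  "tables \<equiv> {lift, grow, finish}"

abbreviation start :: sym where
  "start \<equiv> Open None (Odd False)"

lemma derives_settle: "moves w \<Longrightarrow> derives tables [start] (settle None w None)"
proof (induction rule: moves.induct)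
  case (turns w)
  then have "settle None w None \<in> outcomes start" by auto
  then show ?case
    by (intro derives_mono[of "{grow}", OF _ grow_outcome]) auto
next
  case (section_moves s w)
  let ?v = "settle None (section_word s w) None"
  obtain n F where F: "hd ?v = Settled None n" "par_step lift (tl ?v) F"
    "par_step outcomes (Open None (Silent s n) # F) (settle None w None)"
    using lift_complete[of s w "section_word s w" None None] by blast
  have "?v = Settled None n # tl ?v"
    using F(1) by (cases "section_word s w") auto
  moreover have "[Open None (Silent s n)] \<in> lift (Settled None n)" by auto
  ultimately have "par_step lift ?v (Open None (Silent s n) # F)"
    using F(2) by (metis par_step_Cons append_Cons append_Nil)
  then have "derives tables ?v (Open None (Silent s n) # F)"
    by (auto intro: derives_step)
  moreover have "derives tables (Open None (Silent s n) # F) (settle None w None)"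
    by (intro derives_mono[of "{grow}", OF _ grow_outcomes[OF F(3)]]) auto
  ultimately show ?case
    using section_moves.IH derives_trans by blast
qed

lemma finish_settle:
  "par_step finish (settle y w n) F \<longleftrightarrow>
     F = (case y of None \<Rightarrow> [] | Some x \<Rightarrow> [Term x]) @ map Term w"
  by (induction w arbitrary: y F) (auto simp: par_step_Cons split: option.splits)

text \<open>
  The invariant speaks of the outcomes of a list instead of the list itself, so that it covers
  half-grown lists and holds vacuously for lists with a dead symbol.
\<close>

definition sound :: "sym list \<Rightarrow> bool" where
  "sound F \<longleftrightarrow> (\<forall>G. par_step outcomes F G \<longrightarrow>
     (\<exists>w. moves w \<and> (G = settle None w None \<or> G = map Term w)))"

text \<open>
  For the tables \<open>lift\<close> and \<open>finish\<close>: if the result has an outcome, it has no dead symbol, so the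
  list before had neither gaps nor dead symbols and was its own outcome.
\<close>

lemma outcomes_self:
  assumes "\<And>c v. v \<in> R c \<Longrightarrow> Dead \<notin> set v \<Longrightarrow> outcomes c = {[c]}"
  shows "par_step R F F' \<Longrightarrow> par_step outcomes F' G \<Longrightarrow> par_step outcomes F F"
proof (induction F arbitrary: F' G)
  case (Cons c F)
  then obtain v F'' where v: "v \<in> R c" "par_step R F F''" "F' = v @ F''"
    by (auto simp: par_step_Cons)
  with Cons.prems obtain G' G'' where "par_step outcomes v G'" "par_step outcomes F'' G''"
    by (auto simp: par_step_append)
  moreover from this have "Dead \<notin> set v"
    by (auto simp: in_set_conv_decomp par_step_append par_step_Cons)
  ultimately show ?case
    using Cons.IH v assms by (auto simp: par_step_Cons)
qed simp

lemma par_step_map_Term: "(\<And>x. R (Term x) = {[Term x]}) \<Longrightarrow>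
    par_step R (map Term w) F \<longleftrightarrow> F = map Term w"
  by (induction w arbitrary: F) (auto simp: par_step_Cons)

lemma sound_step:
  assumes "sound F" "R \<in> tables" "par_step R F F'"
  shows "sound F'"
proof (cases "R = grow")
  case True
  with assms show ?thesis
    using par_step_grow_outcomes by (auto simp: sound_def)
next
  case False
  with assms consider "R = lift" | "R = finish" by auto
  note R = this
  have self: "outcomes c = {[c]}" if "v \<in> R c" "Dead \<notin> set v" for c v
  proof -
    from that(1) R have "v \<in> lift c \<or> v \<in> finish c" by blast
    with that(2) show ?thesis by (cases c) auto
  qed
  show ?thesis
    unfolding sound_def
  proof (intro allI impI)
    fix G assume G: "par_step outcomes F' G"
    have "par_step outcomes F F"
      by (rule outcomes_self[OF _ assms(3) G]) (rule self)
    with \<open>sound F\<close> obtain w where w: "moves w" "F = settle None w None \<or> F = map Term w"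
      by (auto simp: sound_def)
    from w(2) show "\<exists>w. moves w \<and> (G = settle None w None \<or> G = map Term w)"
    proof
      assume F: "F = map Term w"
      have "F' = map Term w"
        using R assms(3) by cases (auto simp: F par_step_map_Term)
      with G w show ?thesis by (auto simp: par_step_map_Term)
    next
      assume F: "F = settle None w None"
      from R show ?thesis
      proof cases
        assume "R = finish"
        with assms(3) have "F' = map Term w" by (simp add: F finish_settle)
        with G w show ?thesis by (auto simp: par_step_map_Term)
      next
        assume "R = lift"
        obtain n where n: "F = Settled None n # tl F"
          unfolding F by (cases w) auto
        have "par_step lift (Settled None n # tl F) F'"
          using assms(3) \<open>R = lift\<close> n by simp
        then obtain s F'' where "par_step lift (tl F) F''"
          and "F' = Open None (Silent s n) # F''"
          by (auto simp: par_step_Cons)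
        moreover have "hd F = Settled None n" using n by (metis list.sel(1))
        ultimately obtain w' where "G = settle None w' None" "section_word s w' = w"
          using lift_sound[of None w n F'' None s G] G unfolding F by blast
        with w(1) show ?thesis
          by (blast intro: moves.section_moves)
      qed
    qed
  qed
qed

lemma sound_derives: "derives tables F F' \<Longrightarrow> sound F \<Longrightarrow> sound F'"
  unfolding derives_def by (induction rule: rtranclp_induct) (auto intro: sound_step)

lemma derives_map_Term_iff: "derives tables [start] (map Term w) \<longleftrightarrow> moves w"
proof
  assume "moves w"
  then have "derives tables [start] (settle None w None)"
    by (rule derives_settle)
  moreover have "derives tables (settle None w None) (map Term w)"
    by (rule derives_step[of finish]) (auto simp: finish_settle)
  ultimately show "derives tables [start] (map Term w)"
    by (rule derives_trans)
next
  have "sound [start]"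
    by (auto simp: sound_def par_step_Cons intro: moves.turns)
  moreover assume "derives tables [start] (map Term w)"
  ultimately have "sound (map Term w)"
    using sound_derives by blast
  then obtain w' where "moves w'" "map Term w = settle None w' None \<or> map Term w = map Term w'"
    by (auto simp: sound_def par_step_map_Term)
  moreover have "map Term w \<noteq> settle None w' None" for w'
    by (cases w; cases w') auto
  ultimately show "moves w"
    by (metis inj_map_eq_map injI sym.inject(1))
qed

theorem theorem21:
  "ET0L {La, Lb, Lc, Ld} (coword_problem grigorchuk_group act {La, Lb, Lc, Ld})"
proof -
  have "ET0L {La, Lb, Lc, Ld} {w \<in> lists {La, Lb, Lc, Ld}. derives tables [start] (map Term w)}"
    using finite_lift finite_grow finite_finish lift_nonempty grow_nonempty finish_nonempty
    by (intro ET0L_derives) (auto simp: inj_on_def)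
  moreover have "lists {La, Lb, Lc, Ld} = UNIV"
    using letter.exhaust by auto
  ultimately show ?thesis
    by (simp add: derives_map_Term_iff coword_problem_grigorchuk)
qed

end
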